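(* Let $p>3$ be a prime. Then $$\sum_{k=0}^{p-1}\frac{\binom{2k}{k}^2\binom{4k}{2k}}{648^k}\equiv0\pmod{p^2}\quad\text{for } p\equiv3\pmod4,$$ $$\sum_{k=0}^{p-1}\frac{\binom{2k}{k}^2\binom{4k}{2k}}{(-144)^k}\equiv0\pmod{p^2}\quad\text{for } p\equiv2\pmod3,$$ $$\sum_{k=0}^{p-1}\frac{\binom{2k}{k}^2\binom{4k}{2k}}{(-3969)^k}\equiv0\pmod{p^2}\quad\text{for } p\equiv3,5,6\pmod7.$$
   Context: Congruences between rational numbers modulo $p^2$ are taken in the ring of rationals whose denominators are coprime to $p$. *)

theory Defs
  imports Complex_Main "HOL-Computational_Algebra.Primes"
begin

definition p_integers :: "nat \<Rightarrow> rat set" where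
  "p_integers p = {x. coprime (snd (quotient_of x)) (int p)}"

text \<open>Congruence in the ring \<open>p_integers p\<close>, so both sides are required to lie in it. The cofactor must lie in the ring as well, since divisibility in
  the field of all rationals is trivial.\<close>

definition rat_cong :: "nat \<Rightarrow> rat \<Rightarrow> rat \<Rightarrow> rat \<Rightarrow> bool" where
  "rat_cong p m x y \<longleftrightarrow>
     x \<in> p_integers p \<and> y \<in> p_integers p \<and> (\<exists>z\<in>p_integers p. x - y = m * z)"

end

theory Submission
  imports
    Defs
    "HOL-Number_Theory.Quadratic_Reciprocity"
    "HOL-Computational_Algebra.Polynomial_FPS"
begin

text \<open>
Write \<open>c\<^sub>k = (2k choose k) (4k choose 2k)\<close>; the sums have the form \<open>\<Sum>k<p. (2k choose k) c\<^sub>k / m^k\<close>. The three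
values of \<open>m\<close> satisfy \<open>1/m = x (1 - 64 x)\<close> with \<open>x = 1/72\<close>, \<open>1/48\<close> and \<open>1/63\<close>.

Clausen's formula gives \<open>\<Sum>k. (2k choose k) c\<^sub>k (x (1 - 64 x))^k = (\<Sum>k. c\<^sub>k x^k)\<^sup>2\<close> as power series
(\<open>quart_clausen\<close>; both sides satisfy one third-order differential equation). The same identity holds modulo
\<open>p\<^sup>2\<close> for the polynomials truncated at \<open>k < p\<close> (\<open>quart_clausen_truncated\<close>), because all the coefficients of degree
at least \<open>p\<close> are divisible by \<open>p\<^sup>2\<close>. It therefore suffices that \<open>p\<close> divides \<open>\<Sum>k<p. c\<^sub>k x^k\<close>.

Let \<open>n = (p - 1)/2\<close> and \<open>x = b / (16 a\<^sup>2)\<close>. Modulo \<open>p\<close> this last sum is, up to the unit \<open>a^n\<close>, the coefficient of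
\<open>X^(p-1)\<close> in \<open>(X\<^sup>3 + a X\<^sup>2 + b X)^n\<close> (\<open>sum_quart_dvd\<close>), the Hasse invariant of an elliptic curve. The three
values of \<open>x\<close> correspond to \<open>(a, b) = (3, 2)\<close>, \<open>(3, 3)\<close> and \<open>(21, 112)\<close>, curves with complex multiplication by orders
of discriminant \<open>-4\<close>, \<open>-3\<close> and \<open>-7\<close>, and the conditions on \<open>p\<close> say that \<open>p\<close> is inert, so that the
reduction is supersingular.

The Hasse invariant is shown to vanish by elementary means, all resting on its invariance under translations of \<open>X\<close>
(\<open>coeff_cubic_shift_cong\<close>). The first two curves are translates of \<open>u\<^sup>3 - u\<close> and \<open>u\<^sup>3 - 1\<close>, where the
coefficient is zero for trivial reasons. For the third one, the endomorphism of degree 2 is used: translation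
invariance implies that the Hasse invariant does not change under 2-isogenies (\<open>central_trinomial_isogeny\<close>), and over
the integers extended by a square root of \<open>-7\<close> this gives a relation that forces the invariant to vanish when
\<open>-7\<close> is not a square modulo \<open>p\<close> (\<open>central_trinomial_21_112\<close>).
\<close>

unbundle fps_syntax

section \<open>Divisibility of binomial coefficients by a prime\<close>

lemma central_binomial_rec:
  "Suc n * ((2 * Suc n) choose (Suc n)) = 2 * (2 * n + 1) * ((2 * n) choose n)"
proof -
  have a: "Suc n * ((2 * Suc n) choose (Suc n)) = 2 * Suc n * (Suc (2 * n) choose n)"
    using Suc_times_binomial[of n "Suc (2 * n)"] by simp
  have b: "Suc n * (Suc (2 * n) choose n) = Suc (2 * n) * ((2 * n) choose n)"
    using binomial_absorb_comp[of "Suc (2 * n)" n] by (simp add: Suc_diff_le)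
  show ?thesis
    using a b by (metis Suc_eq_plus1 mult.assoc)
qed

text \<open>The integers \<open>(4 k)! / (k!\<^sup>2 (2 k)!)\<close>, the coefficients of \<open>2F1(1/4, 3/4; 1; 64 x)\<close>.\<close>
definition quart :: "nat \<Rightarrow> nat" where
  "quart k = ((2 * k) choose k) * ((4 * k) choose (2 * k))"

lemma quart_rec:
  "Suc k ^ 2 * quart (Suc k) = 4 * (4 * k + 1) * (4 * k + 3) * quart k"
proof -
  define b where "b = (\<lambda>n. (2 * n) choose n :: nat)"
  have rec: "Suc n * b (Suc n) = 2 * (2 * n + 1) * b n" for n
    unfolding b_def by (rule central_binomial_rec)
  have q: "quart n = b n * b (2 * n)" for n
    by (simp add: quart_def b_def)
  have "2 * (2 * k + 1) * (Suc k ^ 2 * quart (Suc k))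
      = (Suc k * b (Suc k)) * (Suc (2 * k) * (Suc (Suc (2 * k)) * b (Suc (Suc (2 * k)))))"
    by (simp add: q power2_eq_square algebra_simps)
  also have "\<dots> = (2 * (2 * k + 1) * b k) * (2 * (2 * Suc (2 * k) + 1) * (Suc (2 * k) * b (Suc (2 * k))))"
    by (subst rec, subst rec) (simp only: mult_ac)
  also have "\<dots> = (2 * (2 * k + 1) * b k) * (2 * (2 * Suc (2 * k) + 1) * (2 * (2 * (2 * k) + 1) * b (2 * k)))"
    by (subst rec) simp
  also have "\<dots> = 2 * (2 * k + 1) * (4 * (4 * k + 1) * (4 * k + 3) * quart k)"
    by (simp add: q algebra_simps)
  finally show ?thesis
    by (subst (asm) mult_cancel_left) simp
qed

lemma quart_central_rec:
  "Suc k ^ 3 * (((2 * Suc k) choose Suc k) * quart (Suc k))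
     = 8 * (2 * k + 1) * (4 * k + 1) * (4 * k + 3) * (((2 * k) choose k) * quart k)"
proof -
  have "Suc k ^ 3 * (((2 * Suc k) choose Suc k) * quart (Suc k))
     = (Suc k * ((2 * Suc k) choose Suc k)) * (Suc k ^ 2 * quart (Suc k))"
    by (simp only: power3_eq_cube power2_eq_square mult_ac)
  thus ?thesis
    by (simp only: quart_rec central_binomial_rec) (simp add: algebra_simps)
qed

lemma prime_dvd_choose:
  assumes "prime (p::nat)" "k < p" "n - k < p" "p \<le> n" "k \<le> n"
  shows "p dvd (n choose k)"
proof -
  have "p dvd fact k * fact (n - k) * (n choose k)"
    using assms by (simp add: binomial_fact_lemma prime_dvd_fact_iff)
  thus ?thesis
    using assms by (auto simp: prime_dvd_mult_iff prime_dvd_fact_iff)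
qed

text \<open>The hypotheses say \<open>m = p + s\<close> with \<open>p/2 \<le> s < p\<close>: there is a carry out of the units digit in \<open>m + m\<close>
in base \<open>p\<close>. In terms of factorials, \<open>p\<^sup>3\<close> divides \<open>(2 m)!\<close>, while \<open>p\<close> divides \<open>m!\<close> exactly once.\<close>
lemma prime_dvd_central_binomial_three:
  assumes p: "prime (p::nat)" and m: "p \<le> m" "m < 2 * p" "3 * p \<le> 2 * m"
  shows "p dvd ((2 * m) choose m)"
proof -
  have p0: "p > 0" using p prime_gt_0_nat by blast
  define u where "u = \<Prod>({1..m} - {p})"
  have fm: "fact m = p * u"
    unfolding fact_prod u_def using m p0 by (subst prod.remove[of _ p]) auto
  have "\<not> p dvd u"
  proof
    assume "p dvd u"
    hence "\<exists>i\<in>{1..m} - {p}. p dvd i"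
      using p unfolding u_def by (subst (asm) prime_dvd_prod_iff) auto
    then obtain i where i: "i \<in> {1..m} - {p}" "p dvd i" by blast
    then obtain c where c: "i = p * c" by auto
    have "c \<noteq> 0" "c \<noteq> 1" using i c by auto
    hence "2 * p \<le> i" using c by (cases c) auto
    thus False using i m by auto
  qed
  have "\<Prod>{p, 2 * p, 3 * p} dvd \<Prod>{1..2 * m}"
    using m p0 by (intro prod_dvd_prod_subset) auto
  moreover have "\<Prod>{p, 2 * p, 3 * p} = 6 * p ^ 3"
    using p0 by (simp add: power3_eq_cube)
  ultimately have "p ^ 3 dvd fact (2 * m)"
    unfolding fact_prod by (metis dvd_mult_right of_nat_id)
  also have "fact (2 * m) = fact m * fact m * ((2 * m) choose m)"
    using binomial_fact_lemma[of m "2 * m"] by simp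
  also have "\<dots> = p ^ 2 * (u * u * ((2 * m) choose m))"
    by (simp add: fm power2_eq_square algebra_simps)
  finally have "p dvd u * u * ((2 * m) choose m)"
    using p0 by (simp add: power3_eq_cube power2_eq_square mult.assoc)
  thus ?thesis using \<open>\<not> p dvd u\<close> p by (simp add: prime_dvd_mult_iff)
qed

lemma prime_dvd_quart:
  assumes p: "prime (p::nat)" and k: "k < p" "p \<le> 4 * k"
  shows "p dvd quart k"
proof (cases "p \<le> 2 * k")
  case True
  thus ?thesis using prime_dvd_choose[OF p, of k "2 * k"] k by (simp add: quart_def)
next
  case False
  thus ?thesis using prime_dvd_choose[OF p, of "2 * k" "4 * k"] k by (simp add: quart_def)
qed

lemma prime_square_dvd_quart:
  assumes p: "prime (p::nat)" and k: "k < p" "3 * p \<le> 4 * k"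
  shows "p ^ 2 dvd quart k"
proof -
  have "p dvd ((2 * k) choose k)"
    using prime_dvd_choose[OF p, of k "2 * k"] k by simp
  moreover have "p dvd ((4 * k) choose (2 * k))"
    using prime_dvd_central_binomial_three[OF p, of "2 * k"] k by simp
  ultimately show ?thesis
    unfolding quart_def power2_eq_square by (rule mult_dvd_mono)
qed

text \<open>If one index is below \<open>p/4\<close>, the other is above \<open>3p/4\<close> and contributes \<open>p\<^sup>2\<close> alone; otherwise each factor
contributes a \<open>p\<close>.\<close>
lemma prime_square_dvd_quart_mult:
  assumes p: "prime (p::nat)" and jl: "j < p" "l < p" "p \<le> j + l"
  shows "p ^ 2 dvd quart j * quart l"
proof -
  consider "p \<le> 4 * j" "p \<le> 4 * l" | "4 * j < p" | "4 * l < p" by linarith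
  thus ?thesis
  proof cases
    case 1
    thus ?thesis unfolding power2_eq_square
      using p jl by (intro mult_dvd_mono prime_dvd_quart) auto
  next
    case 2
    thus ?thesis using prime_square_dvd_quart[OF p, of l] jl by simp
  next
    case 3
    thus ?thesis using prime_square_dvd_quart[OF p, of j] jl by simp
  qed
qed

text \<open>The congruence \<open>(n choose i) \<equiv> (-1/2 choose i) = (2i choose i) / (-4)^i\<close>, valid because \<open>n = (p - 1)/2 \<equiv> -1/2\<close>.\<close>
lemma binomial_half_cong:
  assumes p: "prime p" "p = 2 * n + 1" and i: "i < p"
  shows "int p dvd (- 4) ^ i * int (n choose i) - int ((2 * i) choose i)"
  using i
proof (induction i)
  case (Suc i)
  define a where "a = (- 4) ^ i * int (n choose i)"
  define b where "b = int ((2 * i) choose i)"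
  have IH: "int p dvd a - b" using Suc by (simp add: a_def b_def)
  have "Suc i * (n choose Suc i) + i * (n choose i) = n * (n choose i)"
  proof (cases "i \<le> n")
    case True
    have "Suc i * (n choose Suc i) = (n - i) * (n choose i)"
      using binomial_absorb_comp[of n i] binomial_absorption[of i n] by simp
    hence "Suc i * (n choose Suc i) + i * (n choose i) = (n - i + i) * (n choose i)"
      by (simp only: add_mult_distrib)
    thus ?thesis using True by simp
  qed (simp add: binomial_eq_0)
  hence "int (Suc i * (n choose Suc i) + i * (n choose i)) = int (n * (n choose i))" by simp
  hence c: "int (Suc i) * int (n choose Suc i) = (int n - int i) * int (n choose i)"
    by (simp add: algebra_simps)
  have "int (Suc i) * ((- 4) ^ Suc i * int (n choose Suc i))
      = - 4 * (- 4) ^ i * (int (Suc i) * int (n choose Suc i))" by simp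
  also have "\<dots> = (4 * int i + 2 - 2 * int p) * a"
    unfolding c a_def using p(2) by (simp add: algebra_simps)
  finally have 1: "int (Suc i) * ((- 4) ^ Suc i * int (n choose Suc i)) = (4 * int i + 2 - 2 * int p) * a" .
  have 2: "int (Suc i) * int ((2 * Suc i) choose Suc i) = (4 * int i + 2) * b"
    using arg_cong[OF central_binomial_rec[of i], of int] by (simp add: b_def algebra_simps)
  have "int (Suc i) * ((- 4) ^ Suc i * int (n choose Suc i) - int ((2 * Suc i) choose Suc i))
     = (4 * int i + 2) * (a - b) - int p * (2 * a)"
    unfolding right_diff_distrib 1 2 by (simp add: algebra_simps)
  moreover have "int p dvd (4 * int i + 2) * (a - b) - int p * (2 * a)"
    by (rule dvd_diff[OF dvd_mult[OF IH] dvd_triv_left])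
  ultimately have "int p dvd int (Suc i) * ((- 4) ^ Suc i * int (n choose Suc i) - int ((2 * Suc i) choose Suc i))"
    by simp
  moreover have "\<not> int p dvd int (Suc i)"
    unfolding int_dvd_int_iff using Suc.prems by (auto dest: dvd_imp_le)
  moreover have "prime (int p)" using p(1) by simp
  ultimately show ?case
    by (metis prime_dvd_mult_iff)
qed simp

section \<open>A Clausen identity as a power series identity\<close>

text \<open>The polynomial \<open>D = x (1 - 64 x)\<close> as a power series. It is both the coefficient function of the
self-adjoint differential equation \<open>(D f')' = 12 f\<close> and the inner function of the quadratic substitution.\<close>
definition quartD :: "int fps" where
  "quartD = fps_X - fps_const 64 * fps_X ^ 2"

lemma quartD_nth [simp]: "quartD $ n = (if n = 1 then 1 else if n = 2 then - 64 else 0)"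
  by (simp add: quartD_def fps_X_power_nth)

lemma quartD_mult_nth:
  "(quartD * g) $ n = (if n = 0 then 0 else g $ (n - 1)) - 64 * (if n < 2 then 0 else g $ (n - 2))"
proof -
  have "quartD * g = fps_X * g - fps_const 64 * (fps_X * (fps_X * g))"
    by (simp add: quartD_def algebra_simps power2_eq_square)
  thus ?thesis by (cases n; cases "n - 1") auto
qed

lemma quartD_deriv: "fps_deriv quartD = 1 - fps_const 128 * fps_X"
  by (rule fps_ext) auto

lemma quartD_deriv_mult_nth:
  "(fps_deriv quartD * g) $ n = g $ n - 128 * (if n = 0 then 0 else g $ (n - 1))"
  by (simp add: quartD_deriv ring_distribs mult.assoc)

text \<open>The hypergeometric equation for \<open>2F1(1/4, 3/4; 1; 64 x)\<close> in self-adjoint form.\<close>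
lemma quart_ode:
  defines "f \<equiv> Abs_fps (\<lambda>k. int (quart k))"
  shows "fps_deriv (quartD * fps_deriv f) = fps_const 12 * f"
proof (rule fps_ext)
  fix n
  have rec: "int (Suc n) ^ 2 * int (quart (Suc n)) = 4 * (4 * int n + 1) * (4 * int n + 3) * int (quart n)"
    using arg_cong[OF quart_rec[of n], of int] by (simp add: algebra_simps)
  have "fps_deriv (quartD * fps_deriv f) $ n
      = int (Suc n) * (int (Suc n) * int (quart (Suc n)) - 64 * int n * int (quart n))"
    by (cases n) (simp_all add: f_def quartD_mult_nth numeral_2_eq_2 algebra_simps del: fps_deriv_mult)
  also have "\<dots> = int (Suc n) ^ 2 * int (quart (Suc n)) - 64 * int n * int (Suc n) * int (quart n)"
    by (simp add: algebra_simps power2_eq_square)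
  also have "\<dots> = 12 * int (quart n)"
    unfolding rec by (simp add: algebra_simps)
  finally show "fps_deriv (quartD * fps_deriv f) $ n = (fps_const 12 * f) $ n"
    by (simp add: f_def)
qed

text \<open>The third-order operator \<open>u \<mapsto> (D (D u')')' - 48 D u' - 24 D' u\<close>, the symmetric square of the operator
\<open>f \<mapsto> (D f')' - 12 f\<close>: it annihilates the square of every solution of \<open>(D f')' = 12 f\<close>.\<close>
definition symode :: "int fps \<Rightarrow> int fps" where
  "symode u = fps_deriv (quartD * fps_deriv (quartD * fps_deriv u))
     - fps_const 48 * (quartD * fps_deriv u) - fps_const 24 * (fps_deriv quartD * u)"

lemma symode_diff: "symode (u - v) = symode u - symode v"
  by (simp add: symode_def algebra_simps)

lemma symode_square:
  assumes "fps_deriv (quartD * fps_deriv f) = fps_const 12 * f"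
  shows "symode (f ^ 2) = 0"
proof -
  define v where "v = quartD * fps_deriv f"
  have dv: "fps_deriv v = fps_const 12 * f" using assms by (simp add: v_def)
  have two: "2 = fps_const (2::int)" by (simp add: numeral_fps_const)
  have a: "quartD * fps_deriv (f ^ 2) = 2 * (f * v)"
    by (simp add: v_def power2_eq_square algebra_simps)
  have b: "quartD * fps_deriv (2 * (f * v)) = 2 * v ^ 2 + fps_const 24 * (quartD * f ^ 2)"
  proof -
    have "quartD * fps_deriv (2 * (f * v)) = 2 * ((quartD * fps_deriv f) * v + quartD * f * fps_deriv v)"
      by (simp add: two algebra_simps)
    also have "\<dots> = 2 * v ^ 2 + 2 * fps_const 12 * (quartD * f ^ 2)"
      unfolding dv v_def[symmetric] by (simp add: algebra_simps power2_eq_square)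
    finally show ?thesis by (simp add: two)
  qed
  have c: "fps_deriv (2 * v ^ 2) = fps_const 48 * (f * v)"
  proof -
    have "fps_deriv (2 * v ^ 2) = 2 * 2 * (v * fps_deriv v)"
      by (simp add: two power2_eq_square algebra_simps)
    also have "\<dots> = 2 * 2 * fps_const 12 * (f * v)"
      unfolding dv by (simp add: algebra_simps)
    finally show ?thesis by (simp add: two)
  qed
  have d: "fps_deriv (fps_const 24 * (quartD * f ^ 2))
      = fps_const 24 * (fps_deriv quartD * f ^ 2) + fps_const 24 * (quartD * fps_deriv (f ^ 2))"
    by (simp add: algebra_simps)
  have e: "fps_const 48 * (f * v) = fps_const 24 * (quartD * fps_deriv (f ^ 2))"
    unfolding a by (simp add: two mult.assoc[symmetric])
  have g: "fps_const 48 * (2 * (f * v)) = fps_const 48 * (f * v) + fps_const 48 * (f * v)"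
    by (simp only: mult_2 distrib_left)
  have "symode (f ^ 2) = fps_deriv (2 * v ^ 2 + fps_const 24 * (quartD * f ^ 2))
      - fps_const 48 * (2 * (f * v)) - fps_const 24 * (fps_deriv quartD * f ^ 2)"
    unfolding symode_def a b ..
  also have "\<dots> = 0"
    unfolding fps_deriv_add c d g e[symmetric] by simp
  finally show ?thesis .
qed

text \<open>The coefficient of \<open>x^m\<close> in \<open>symode u\<close> is \<open>(m + 1)\<^sup>3 u(m+1)\<close> plus a combination of
coefficients of lower index.\<close>
lemma symode_unique:
  assumes "symode u = 0" and "u $ 0 = 0"
  shows "u = 0"
proof -
  have "u $ n = 0" for n
  proof (induction n rule: less_induct)
    case (less n)
    show ?case
    proof (cases n)
      case 0
      thus ?thesis using assms(2) by simp
    next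
      case (Suc m)
      have z: "u $ j = 0" if "j \<le> m" for j using less Suc that by simp
      have "symode u $ m = int (Suc m) ^ 3 * u $ Suc m"
        unfolding symode_def fps_sub_nth fps_mult_left_const_nth quartD_deriv_mult_nth
        by (cases m; cases "m - 1")
           (auto simp: quartD_mult_nth z power3_eq_cube algebra_simps simp del: fps_deriv_mult)
      thus ?thesis using assms(1) Suc by simp
    qed
  qed
  thus ?thesis by (simp add: fps_eq_iff)
qed

lemma fps_XD_compose:
  "h * fps_deriv (g oo h) = fps_deriv h * ((fps_X * fps_deriv g) oo h)"
  if "h $ 0 = 0" for h g :: "int fps"
  using that by (simp add: fps_compose_deriv fps_compose_mult_distrib algebra_simps)

text \<open>The hypothesis is the recurrence of \<open>3F2(1/4, 1/2, 3/4; 1, 1; 256 w)\<close>. Since \<open>D'\<^sup>2 = 1 - 256 D\<close>, the operator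
applied to \<open>G(D(x))\<close> becomes \<open>D'\<close> times an operator in \<open>w = D(x)\<close> applied to \<open>G\<close>.\<close>
lemma symode_compose:
  fixes G :: "int fps"
  assumes rec: "\<And>k. int (Suc k) ^ 3 * G $ Suc k
      = 8 * (2 * int k + 1) * (4 * int k + 1) * (4 * int k + 3) * G $ k"
  shows "symode (G oo quartD) = 0"
proof -
  \<comment> \<open>the Euler operator \<open>w d/dw\<close>\<close>
  define E where "E = (\<lambda>g :: int fps. fps_X * fps_deriv g)"
  have D0: "quartD $ 0 = 0" by (simp add: quartD_def)
  have cd: "fps_deriv (g oo quartD) = (fps_deriv g oo quartD) * fps_deriv quartD" for g
    using D0 by (rule fps_compose_deriv)
  have dd: "fps_deriv (fps_deriv quartD) = - fps_const 128"
    by (simp add: quartD_deriv)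
  have sq: "fps_deriv quartD ^ 2 = 1 - fps_const 256 * quartD"
    unfolding quartD_deriv quartD_def
    by (simp add: power2_eq_square algebra_simps numeral_fps_const)
  note XD = fps_XD_compose[OF D0]
  have s1: "quartD * fps_deriv (G oo quartD) = fps_deriv quartD * (E G oo quartD)"
    unfolding XD E_def ..
  have "quartD * fps_deriv (fps_deriv quartD * (E G oo quartD))
      = - fps_const 128 * quartD * (E G oo quartD) + fps_deriv quartD * (quartD * fps_deriv (E G oo quartD))"
    by (simp add: dd algebra_simps)
  also have "\<dots> = - fps_const 128 * quartD * (E G oo quartD) + fps_deriv quartD ^ 2 * (E (E G) oo quartD)"
    unfolding XD E_def by (simp add: power2_eq_square algebra_simps)
  also have "\<dots> = (- fps_const 128 * (fps_X * E G) + (1 - fps_const 256 * fps_X) * E (E G)) oo quartD"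
    unfolding sq by (simp add: D0 fps_compose_add_distrib fps_compose_sub_distrib fps_compose_mult_distrib
         fps_compose_uminus algebra_simps)
  finally have s2: "quartD * fps_deriv (fps_deriv quartD * (E G oo quartD)) =
    (- fps_const 128 * (fps_X * E G) + (1 - fps_const 256 * fps_X) * E (E G)) oo quartD" .
  have key: "fps_deriv (- fps_const 128 * (fps_X * E G) + (1 - fps_const 256 * fps_X) * E (E G))
     = fps_const 48 * E G + fps_const 24 * G"
  proof (rule fps_ext)
    fix n
    have En: "E g $ k = int k * g $ k" for g k
      by (cases k) (simp_all add: E_def)
    have "fps_deriv (- fps_const 128 * (fps_X * E G) + (1 - fps_const 256 * fps_X) * E (E G)) $ n
      = int (Suc n) ^ 3 * G $ Suc n - int (Suc n) * (128 * int n + 256 * int n ^ 2) * G $ n"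
      by (simp add: En ring_distribs mult.assoc fps_deriv_nth power3_eq_cube power2_eq_square
            flip: fps_const_neg)
    also have "\<dots> = (48 * int n + 24) * G $ n"
      unfolding rec by (simp add: algebra_simps power2_eq_square)
    finally show "fps_deriv (- fps_const 128 * (fps_X * E G) + (1 - fps_const 256 * fps_X) * E (E G)) $ n
       = (fps_const 48 * E G + fps_const 24 * G) $ n"
      by (simp add: En algebra_simps)
  qed
  show ?thesis
    unfolding symode_def s1 s2 unfolding cd key
    by (simp add: D0 fps_compose_add_distrib fps_compose_mult_distrib algebra_simps del: fps_deriv_mult)
qed

text \<open>Clausen's formula combined with a quadratic transformation: both sides solve the same third-order
equation and have constant term 1.\<close>
lemma quart_clausen:
  "Abs_fps (\<lambda>k. int (((2 * k) choose k) * quart k)) oo quartD = Abs_fps (\<lambda>k. int (quart k)) ^ 2"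
proof -
  define G where "G = Abs_fps (\<lambda>k. int (((2 * k) choose k) * quart k))"
  define f where "f = Abs_fps (\<lambda>k. int (quart k))"
  have "symode (G oo quartD) = 0"
  proof (rule symode_compose)
    fix k
    show "int (Suc k) ^ 3 * G $ Suc k = 8 * (2 * int k + 1) * (4 * int k + 1) * (4 * int k + 3) * G $ k"
      using arg_cong[OF quart_central_rec[of k], of int]
      unfolding G_def fps_nth_Abs_fps of_nat_mult of_nat_power of_nat_add by simp
  qed
  moreover have "symode (f ^ 2) = 0"
    unfolding f_def by (intro symode_square quart_ode)
  ultimately have "symode ((G oo quartD) - f ^ 2) = 0"
    by (simp add: symode_diff)
  moreover have "((G oo quartD) - f ^ 2) $ 0 = 0"
    by (simp add: G_def f_def quart_def fps_power_zeroth)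
  ultimately have "(G oo quartD) - f ^ 2 = 0" by (rule symode_unique)
  thus ?thesis by (simp add: G_def f_def)
qed

section \<open>The truncated Clausen identity modulo the square of a prime\<close>

lemma fps_of_poly_quartD: "fps_of_poly [:0, 1, - 64:] = quartD"
  by (rule fps_ext) (auto simp: coeff_pCons numeral_2_eq_2 split: nat.splits)

text \<open>Truncating both series at \<open>k < p\<close> does not affect the coefficients of \<open>x^m\<close> with \<open>m < p\<close>. The
coefficients with \<open>m \<ge> p\<close> vanish modulo \<open>p\<^sup>2\<close> on each side: on the left only \<open>k \<ge> p/2\<close> contributes, and on
the right only pairs of indices with sum at least \<open>p\<close>.\<close>
lemma quart_clausen_truncated:
  assumes p: "prime p"
  defines "L \<equiv> \<Sum>k<p. smult (int (((2 * k) choose k) * quart k)) ([:0, 1, - 64:] ^ k)"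
      and "S \<equiv> \<Sum>k<p. monom (int (quart k)) k"
  shows "int p ^ 2 dvd coeff (L - S ^ 2) m"
proof -
  define G where "G = (\<lambda>k. int (((2 * k) choose k) * quart k))"
  have cS: "coeff S i = (if i < p then int (quart i) else 0)" for i
    by (simp add: S_def coeff_sum)
  have cS2: "coeff (S ^ 2) m = (\<Sum>i\<le>m. coeff S i * coeff S (m - i))"
    by (simp add: power2_eq_square coeff_mult)
  have cL: "coeff L m = (\<Sum>k<p. G k * coeff ([:0, 1, - 64:] ^ k) m)"
    by (simp add: L_def G_def coeff_sum)
  show ?thesis
  proof (cases "m < p")
    case True
    have Dk: "coeff ([:0, 1, - 64:] ^ k) m = (quartD ^ k) $ m" for k
      unfolding fps_of_poly_quartD[symmetric] fps_of_poly_power[symmetric] by simp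
    have "coeff L m = (\<Sum>k<p. G k * (quartD ^ k) $ m)"
      by (simp add: cL Dk)
    also have "\<dots> = (\<Sum>k\<in>{0..m}. G k * (quartD ^ k) $ m)"
      using True by (intro sum.mono_neutral_right) (auto simp: startsby_zero_power_prefix)
    also have "\<dots> = (Abs_fps G oo quartD) $ m"
      by (simp add: fps_compose_nth)
    also have "\<dots> = (Abs_fps (\<lambda>k. int (quart k)) ^ 2) $ m"
      unfolding G_def quart_clausen ..
    also have "\<dots> = coeff (S ^ 2) m"
      unfolding cS2 using True
      by (auto simp: power2_eq_square fps_mult_nth cS atLeast0AtMost intro!: sum.cong)
    finally show ?thesis by simp
  next
    case False
    have "int p ^ 2 dvd coeff S i * coeff S (m - i)" if "i \<le> m" for i
    proof (cases "i < p \<and> m - i < p")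
      case True
      hence "int (p ^ 2) dvd int (quart i * quart (m - i))"
        using False that by (intro of_nat_dvd_iff[THEN iffD2] prime_square_dvd_quart_mult[OF p]) auto
      thus ?thesis using True by (simp add: cS)
    qed (auto simp: cS)
    hence 1: "int p ^ 2 dvd coeff (S ^ 2) m"
      unfolding cS2 by (intro dvd_sum) auto
    have "int p ^ 2 dvd G k * coeff ([:0, 1, - 64:] ^ k) m" if k: "k < p" for k
    proof (cases "m \<le> 2 * k")
      case True
      have "p dvd ((2 * k) choose k)" "p dvd quart k"
        using prime_dvd_choose[OF p, of k "2 * k"] prime_dvd_quart[OF p, of k] k True False by auto
      hence "p ^ 2 dvd ((2 * k) choose k) * quart k"
        unfolding power2_eq_square by (rule mult_dvd_mono)
      hence "int (p ^ 2) dvd int (((2 * k) choose k) * quart k)"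
        by (rule of_nat_dvd_iff[THEN iffD2])
      thus ?thesis by (simp add: G_def)
    next
      case False
      have "degree ([:0, 1, - 64 :: int:] ^ k) \<le> 2 * k"
        using degree_power_le[of "[:0, 1, - 64 :: int:]" k] by simp
      thus ?thesis using False by (simp add: coeff_eq_0)
    qed
    hence 2: "int p ^ 2 dvd coeff L m"
      unfolding cL by (intro dvd_sum) auto
    show ?thesis using 1 2 by simp
  qed
qed

section \<open>Central trinomial coefficients and powers of cubics\<close>

text \<open>The coefficient of \<open>X^n\<close> in \<open>(X\<^sup>2 + a X + b)^n\<close>, written out as a sum. For \<open>p = 2 n + 1\<close> this is the coefficient of \<open>X^(p-1)\<close> in
\<open>(X\<^sup>3 + a X\<^sup>2 + b X)^n\<close>, that is, the Hasse invariant of the curve \<open>Y\<^sup>2 = X (X\<^sup>2 + a X + b)\<close>. The ring is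
arbitrary because the invariant is needed both over the integers and over a quadratic extension.\<close>
definition central_trinomial :: "nat \<Rightarrow> 'a::comm_ring_1 \<Rightarrow> 'a \<Rightarrow> 'a" where
  "central_trinomial n a b =
     (\<Sum>k\<le>n div 2. of_nat ((n choose (2 * k)) * ((2 * k) choose k)) * a ^ (n - 2 * k) * b ^ k)"

lemma sum_even_reindex:
  fixes h :: "nat \<Rightarrow> 'a::comm_monoid_add"
  shows "(\<Sum>j\<le>n. if even j then h (j div 2) else 0) = (\<Sum>k\<le>n div 2. h k)"
proof -
  have "(\<Sum>j\<le>n. if even j then h (j div 2) else 0) = (\<Sum>j\<in>{j\<in>{..n}. even j}. h (j div 2))"
    by (rule sum.inter_filter[symmetric]) simp
  also have "\<dots> = (\<Sum>k\<le>n div 2. h k)"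
    by (rule sum.reindex_bij_witness[of _ "\<lambda>k. 2 * k" "\<lambda>j. j div 2"]) (auto elim!: evenE)
  finally show ?thesis .
qed

lemma coeff_square_plus_const_power:
  fixes b :: "'a::comm_ring_1"
  shows "coeff ([:b, 0, 1:] ^ m) j
     = (if even j then of_nat (m choose (j div 2)) * b ^ (m - j div 2) else 0)"
proof -
  have "[:b, 0, 1:] = monom 1 2 + [:b:]"
    by (simp add: monom_altdef power2_eq_square)
  hence "[:b, 0, 1:] ^ m = (\<Sum>i\<le>m. monom (of_nat (m choose i) * b ^ (m - i)) (2 * i))"
    by (simp add: binomial_ring monom_power poly_const_pow of_nat_poly mult_monom smult_monom mult_ac)
  hence "coeff ([:b, 0, 1:] ^ m) j
      = (\<Sum>i\<le>m. if 2 * i = j then of_nat (m choose i) * b ^ (m - i) else 0)"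
    by (simp add: coeff_sum)
  also have "\<dots> = (\<Sum>i\<le>m. if even j \<and> j div 2 = i then of_nat (m choose i) * b ^ (m - i) else 0)"
    by (intro sum.cong) auto
  also have "\<dots> = (if even j then of_nat (m choose (j div 2)) * b ^ (m - j div 2) else 0)"
    by (auto simp: binomial_eq_0)
  finally show ?thesis .
qed

lemma coeff_cubic_power:
  fixes a b :: "'a::comm_ring_1"
  shows "coeff ([:0, b, a, 1:] ^ n) (2 * n) = central_trinomial n a b"
proof -
  define h where "h = (\<lambda>k. of_nat ((n choose (2 * k)) * ((2 * k) choose k)) * a ^ (n - 2 * k) * b ^ k)"
  have "[:0, b, a, 1:] = monom 1 1 * (monom a 1 + [:b, 0, 1:])"
    by (simp add: monom_altdef)
  hence "[:0, b, a, 1:] ^ n = monom 1 n * (\<Sum>j\<le>n. of_nat (n choose j) * monom a 1 ^ j * [:b, 0, 1:] ^ (n - j))"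
    by (simp add: power_mult_distrib monom_power binomial_ring)
  also have "\<dots> = (\<Sum>j\<le>n. monom (of_nat (n choose j) * a ^ j) (n + j) * [:b, 0, 1:] ^ (n - j))"
    by (simp add: sum_distrib_left monom_power of_nat_poly mult_monom smult_monom mult_ac flip: mult.assoc)
  finally have "coeff ([:0, b, a, 1:] ^ n) (2 * n)
      = (\<Sum>j\<le>n. of_nat (n choose j) * a ^ j * coeff ([:b, 0, 1:] ^ (n - j)) (n - j))"
    by (simp add: coeff_sum coeff_monom_mult)
  also have "\<dots> = (\<Sum>j\<le>n. of_nat (n choose j) * a ^ (n - j) * coeff ([:b, 0, 1:] ^ j) j)"
    by (rule sum.reindex_bij_witness[of _ "\<lambda>j. n - j" "\<lambda>j. n - j"]) (auto simp: binomial_symmetric[symmetric])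
  also have "\<dots> = (\<Sum>j\<le>n. if even j then h (j div 2) else 0)"
    by (intro sum.cong) (auto simp: h_def coeff_square_plus_const_power mult_ac elim!: evenE)
  also have "\<dots> = central_trinomial n a b"
    unfolding sum_even_reindex unfolding central_trinomial_def h_def ..
  finally show ?thesis .
qed

lemma coeff_product_power:
  fixes a d :: "'a::comm_ring_1"
  shows "coeff (([:a, 1:] * [:d, 0, 1:]) ^ n) (2 * n)
     = (\<Sum>k\<le>n div 2. of_nat ((n choose (2 * k)) * (n choose k)) * a ^ (n - 2 * k) * d ^ k)"
proof -
  define h where "h = (\<lambda>k. of_nat ((n choose (2 * k)) * (n choose k)) * a ^ (n - 2 * k) * d ^ k)"
  have "[:a, 1:] = monom 1 1 + [:a:]" by (simp add: monom_altdef)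
  hence "[:a, 1:] ^ n = (\<Sum>j\<le>n. monom (of_nat (n choose j) * a ^ (n - j)) j)"
    by (simp add: binomial_ring monom_power poly_const_pow of_nat_poly mult_monom smult_monom mult_ac)
  hence "coeff (([:a, 1:] * [:d, 0, 1:]) ^ n) (2 * n)
      = (\<Sum>j\<le>n. of_nat (n choose j) * a ^ (n - j) * coeff ([:d, 0, 1:] ^ n) (2 * n - j))"
    unfolding power_mult_distrib by (simp add: sum_distrib_right coeff_sum coeff_monom_mult)
  also have "\<dots> = (\<Sum>j\<le>n. if even j then h (j div 2) else 0)"
  proof (intro sum.cong refl)
    fix j assume "j \<in> {..n}"
    hence j: "j \<le> n" by simp
    show "of_nat (n choose j) * a ^ (n - j) * coeff ([:d, 0, 1:] ^ n) (2 * n - j) =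
      (if even j then h (j div 2) else 0)"
    proof (cases "even j")
      case True
      then obtain k where k: "j = 2 * k" by (elim evenE)
      have "2 * n - 2 * k = 2 * (n - k)" by simp
      thus ?thesis
        using j by (simp add: h_def k coeff_square_plus_const_power binomial_symmetric[of k n] mult_ac)
    next
      case False
      thus ?thesis using j by (simp add: coeff_square_plus_const_power)
    qed
  qed
  finally show ?thesis
    unfolding sum_even_reindex unfolding h_def .
qed

lemma pcompose_power:
  fixes q :: "'a::comm_ring_1 poly"
  shows "pcompose (q ^ n) r = pcompose q r ^ n"
  by (induction n) (simp_all add: pcompose_mult pcompose_1)

lemma pcompose_monom:
  fixes q :: "'a::comm_ring_1 poly"
  shows "pcompose (monom c n) q = smult c (q ^ n)"
  by (simp add: monom_altdef pcompose_smult pcompose_power pcompose_pCons)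

text \<open>The coefficient of \<open>X^(p-1)\<close> is translation invariant modulo \<open>p\<close> in degrees below \<open>2p - 1\<close>, since \<open>p\<close> divides
\<open>(i choose (p - 1))\<close> for \<open>p \<le> i \<le> 2p - 2\<close>.\<close>
lemma coeff_shift_cong:
  fixes g :: "'a::comm_ring_1 poly"
  assumes p: "prime p" and deg: "degree g < 2 * p - 1"
  shows "of_nat p dvd coeff (pcompose g [:e, 1:]) (p - 1) - coeff g (p - 1)"
proof -
  define N where "N = 2 * p - 2"
  have p2: "p \<ge> 2" using p by (rule prime_ge_2_nat)
  define t where "t = (\<lambda>i. coeff g i * coeff ([:e, 1:] ^ i) (p - 1))"
  have "degree g \<le> N" using deg by (simp add: N_def)
  hence "g = (\<Sum>i\<le>N. monom (coeff g i) i)"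
    by (rule poly_as_sum_of_monoms'[symmetric])
  hence "pcompose g [:e, 1:] = (\<Sum>i\<le>N. smult (coeff g i) ([:e, 1:] ^ i))"
    by (metis (no_types, lifting) pcompose_sum pcompose_monom sum.cong)
  hence "coeff (pcompose g [:e, 1:]) (p - 1) = (\<Sum>i\<le>N. t i)"
    by (simp add: coeff_sum t_def)
  also have "\<dots> = t (p - 1) + (\<Sum>i\<in>{..N} - {p - 1}. t i)"
    using p2 by (intro sum.remove) (auto simp: N_def)
  also have "t (p - 1) = coeff g (p - 1)"
    by (simp add: t_def coeff_linear_power)
  finally have "coeff (pcompose g [:e, 1:]) (p - 1) - coeff g (p - 1) = (\<Sum>i\<in>{..N} - {p - 1}. t i)"
    by simp
  also have "of_nat p dvd \<dots>"
  proof (intro dvd_sum)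
    fix i assume i: "i \<in> {..N} - {p - 1}"
    show "of_nat p dvd t i"
    proof (cases "i < p - 1")
      case True
      have "degree ([:e, 1:] ^ i) \<le> i"
        using degree_power_le[of "[:e, 1:]" i] degree_pCons_le[of e "[:1:]"] by (simp add: order_trans)
      thus ?thesis using True by (simp add: t_def coeff_eq_0)
    next
      case False
      have "p dvd (i choose (p - 1))"
        using i False p2 by (intro prime_dvd_choose[OF p]) (auto simp: N_def)
      hence "of_nat p dvd (of_nat (i choose (p - 1)) :: 'a)"
        by (auto elim!: dvdE)
      thus ?thesis
        using i False by (simp add: t_def coeff_linear_poly_power)
    qed
  qed
  finally show ?thesis .
qed

lemma coeff_cubic_shift_cong:
  fixes f :: "'a::comm_ring_1 poly"
  assumes p: "prime p" "p = 2 * n + 1" and deg: "degree f \<le> 3"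
  shows "of_nat p dvd coeff (pcompose f [:e, 1:] ^ n) (2 * n) - coeff (f ^ n) (2 * n)"
proof -
  have "degree (f ^ n) \<le> 3 * n"
    using degree_power_le[of f n] deg by (meson mult_le_mono1 order_trans)
  moreover have "n > 0" using p by (cases n) auto
  ultimately have "degree (f ^ n) < 2 * p - 1" using p(2) by linarith
  from coeff_shift_cong[OF p(1) this, of e] show ?thesis
    using p(2) by (simp add: pcompose_power)
qed

text \<open>The curve \<open>Y\<^sup>2 = X (X\<^sup>2 - 2 a X + a\<^sup>2 - 4 b)\<close> is the quotient of \<open>Y\<^sup>2 = X (X\<^sup>2 + a X + b)\<close> by the 2-torsion
point \<open>(0, 0)\<close>, so their Hasse invariants agree. The link is the cubic \<open>(X + a) (X\<^sup>2 - 4 b)\<close>: translation by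
\<open>-a\<close> gives the first curve, and expanding its \<open>n\<close>-th power directly gives the trinomial sum of the second
through \<open>binomial_half_cong\<close>.\<close>
lemma central_trinomial_isogeny:
  fixes a b :: "'a::comm_ring_1"
  assumes p: "prime p" "p = 2 * n + 1"
  shows "of_nat p dvd central_trinomial n (- 2 * a) (a ^ 2 - 4 * b) - central_trinomial n a b"
proof -
  define f where "f = [:a, 1:] * [:- 4 * b, 0, 1:]"
  have f: "f = [:- 4 * a * b, - 4 * b, a, 1:]" by (simp add: f_def mult_ac)
  have "degree f \<le> 3"
    unfolding f by (auto intro!: degree_pCons_le order_trans)
  have "pcompose f [:- a, 1:] = [:0, a ^ 2 - 4 * b, - 2 * a, 1:]"
    by (simp add: f_def pcompose_pCons pcompose_mult power2_eq_square algebra_simps)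
  from coeff_cubic_shift_cong[OF p \<open>degree f \<le> 3\<close>, of "- a", unfolded this coeff_cubic_power]
  have 1: "of_nat p dvd central_trinomial n (- 2 * a) (a ^ 2 - 4 * b) - coeff (f ^ n) (2 * n)" .
  have "coeff (f ^ n) (2 * n) - central_trinomial n a b
     = (\<Sum>k\<le>n div 2. of_int ((- 4) ^ k * int (n choose k) - int ((2 * k) choose k))
            * (of_nat (n choose (2 * k)) * a ^ (n - 2 * k) * b ^ k))"
    unfolding f_def coeff_product_power central_trinomial_def sum_subtractf[symmetric]
    by (intro sum.cong refl) (simp only: of_int_diff of_int_mult of_int_power of_int_minus of_int_numeral
         of_int_of_nat_eq of_nat_mult power_mult_distrib left_diff_distrib right_diff_distrib mult_ac)
  also have "of_nat p dvd \<dots>"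
  proof (intro dvd_sum dvd_mult2)
    fix k assume "k \<in> {..n div 2}"
    hence "k < p" using p(2) by auto
    from binomial_half_cong[OF p this]
    obtain z where "(- 4) ^ k * int (n choose k) - int ((2 * k) choose k) = int p * z" by (elim dvdE)
    thus "of_nat p dvd (of_int ((- 4) ^ k * int (n choose k) - int ((2 * k) choose k)) :: 'a)"
      by simp
  qed
  finally have 2: "of_nat p dvd coeff (f ^ n) (2 * n) - central_trinomial n a b" .
  from dvd_add[OF 1 2] show ?thesis by (simp only: diff_add_cancel add_diff_eq)
qed

lemma central_trinomial_scale:
  fixes a b u :: "'a::comm_ring_1"
  shows "central_trinomial n (u * a) (u ^ 2 * b) = u ^ n * central_trinomial n a b"
  unfolding central_trinomial_def sum_distrib_left
proof (intro sum.cong refl)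
  fix k assume "k \<in> {..n div 2}"
  hence "n - 2 * k + 2 * k = n" by auto
  hence u: "u ^ n = u ^ (n - 2 * k) * (u ^ 2) ^ k" by (metis power_add power_mult)
  show "of_nat ((n choose (2 * k)) * ((2 * k) choose k)) * (u * a) ^ (n - 2 * k) * (u ^ 2 * b) ^ k =
     u ^ n * (of_nat ((n choose (2 * k)) * ((2 * k) choose k)) * a ^ (n - 2 * k) * b ^ k)"
    unfolding u power_mult_distrib by (simp only: mult_ac)
qed

lemma central_trinomial_of_int:
  "central_trinomial n (of_int a) (of_int b) = (of_int (central_trinomial n a b) :: 'a::comm_ring_1)"
  by (simp add: central_trinomial_def)

section \<open>Cubics with vanishing Hasse invariant\<close>

text \<open>The translation \<open>u = X + 1\<close> turns \<open>X (X\<^sup>2 + 3 X + 2)\<close> into \<open>u\<^sup>3 - u\<close>. For odd \<open>n\<close> the coefficient of \<open>u^(2n)\<close> in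
\<open>(u\<^sup>3 - u)^n\<close> vanishes by parity.\<close>
lemma central_trinomial_3_2:
  assumes p: "prime p" "p = 2 * n + 1" and "odd n"
  shows "int p dvd central_trinomial n 3 2"
proof -
  have "pcompose [:0, - 1, 0, 1:] [:1, 1:] = [:0, 2, 3, 1::int:]"
    by (simp add: pcompose_pCons)
  from coeff_cubic_shift_cong[OF p, of "[:0, - 1, 0, 1::int:]" 1, unfolded this coeff_cubic_power]
  have "int p dvd central_trinomial n 3 2 - central_trinomial n 0 (- 1)" by simp
  moreover have "central_trinomial n 0 (- 1 :: int) = 0"
    unfolding central_trinomial_def using \<open>odd n\<close> by (intro sum.neutral) (auto elim!: oddE)
  ultimately show ?thesis by simp
qed

text \<open>The translation \<open>u = X + 1\<close> turns \<open>X (X\<^sup>2 + 3 X + 3)\<close> into \<open>u\<^sup>3 - 1\<close>, and only powers of \<open>u\<^sup>3\<close> occur in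
\<open>(u\<^sup>3 - 1)^n\<close>.\<close>
lemma central_trinomial_3_3:
  assumes p: "prime p" "p = 2 * n + 1" and "\<not> 3 dvd n"
  shows "int p dvd central_trinomial n 3 3"
proof -
  have "pcompose [:- 1, 0, 0, 1:] [:1, 1:] = [:0, 3, 3, 1::int:]"
    by (simp add: pcompose_pCons)
  from coeff_cubic_shift_cong[OF p, of "[:- 1, 0, 0, 1::int:]" 1, unfolded this coeff_cubic_power]
  have "int p dvd central_trinomial n 3 3 - coeff ([:- 1, 0, 0, 1:] ^ n) (2 * n)" by simp
  moreover have "coeff ([:- 1, 0, 0, 1::int:] ^ n) (2 * n) = 0"
  proof -
    have "[:- 1, 0, 0, 1::int:] = monom 1 3 + [:- 1:]"
      by (simp add: monom_altdef power3_eq_cube)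
    hence "[:- 1, 0, 0, 1::int:] ^ n = (\<Sum>i\<le>n. monom (of_nat (n choose i) * (- 1) ^ (n - i)) (3 * i))"
      by (simp add: binomial_ring monom_power poly_const_pow of_nat_poly mult_monom smult_monom mult_ac)
    hence "coeff ([:- 1, 0, 0, 1::int:] ^ n) (2 * n)
       = (\<Sum>i\<le>n. if 3 * i = 2 * n then of_nat (n choose i) * (- 1) ^ (n - i) else 0)"
      by (simp add: coeff_sum)
    also have "\<dots> = 0"
      using \<open>\<not> 3 dvd n\<close> by (intro sum.neutral) presburger
    finally show ?thesis .
  qed
  ultimately show ?thesis by simp
qed

text \<open>The ring of integers extended by a square root of \<open>-7\<close>; \<open>ZR a b\<close> stands for \<open>a + b sqrt (-7)\<close>.\<close>
datatype zr = ZR (rat_part: int) (root_part: int)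

instantiation zr :: comm_ring_1
begin
definition "0 = ZR 0 0"
definition "1 = ZR 1 0"
definition "x + y = ZR (rat_part x + rat_part y) (root_part x + root_part y)"
definition "- x = ZR (- rat_part x) (- root_part x)"
definition "x - y = ZR (rat_part x - rat_part y) (root_part x - root_part y)"
definition "x * y = ZR (rat_part x * rat_part y - 7 * root_part x * root_part y)
   (rat_part x * root_part y + root_part x * rat_part y)"
instance
  by standard
     (auto simp: zero_zr_def one_zr_def plus_zr_def uminus_zr_def minus_zr_def times_zr_def algebra_simps)
end

definition root7 :: zr where "root7 = ZR 0 1"

lemma of_int_zr: "(of_int m :: zr) = ZR m 0"
proof -
  have n: "(of_nat n :: zr) = ZR (int n) 0" for n
    by (induction n) (simp_all add: zero_zr_def one_zr_def plus_zr_def)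
  show ?thesis
    by (cases m rule: int_cases2) (simp_all add: n uminus_zr_def)
qed

lemma root7_square: "root7 * root7 = - 7"
proof -
  have "- 7 = (of_int (- 7) :: zr)" by simp
  also have "\<dots> = root7 * root7" by (simp only: of_int_zr root7_def times_zr_def) simp
  finally show ?thesis ..
qed

lemma numeral_zr: "(numeral k :: zr) = ZR (numeral k) 0"
  using of_int_zr[of "numeral k"] by simp

lemmas zr_arith = root7_def numeral_zr one_zr_def zero_zr_def plus_zr_def minus_zr_def
  uminus_zr_def times_zr_def power2_eq_square

lemma of_nat_dvd_of_int_zr:
  assumes "(of_nat p :: zr) dvd of_int m"
  shows "int p dvd m"
proof -
  from assms obtain z :: zr where "of_int m = of_int (int p) * z"
    by (auto elim: dvdE)
  hence "m = int p * rat_part z"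
    by (simp add: of_int_zr times_zr_def del: of_int_of_nat_eq)
  thus ?thesis by simp
qed

lemma prime_dvd_add_power_diff:
  fixes x y :: "'a::comm_ring_1"
  assumes p: "prime p"
  shows "of_nat p dvd (x + y) ^ p - (x ^ p + y ^ p)"
proof -
  have p0: "p > 0" using p by (rule prime_gt_0_nat)
  define t where "t = (\<lambda>k. of_nat (p choose k) * x ^ k * y ^ (p - k))"
  have "(x + y) ^ p = (\<Sum>k\<le>p. t k)" by (simp add: binomial_ring t_def)
  also have "\<dots> = t 0 + (t p + (\<Sum>k\<in>{..p} - {0} - {p}. t k))"
    using p0 by (simp add: sum.remove[of "{..p}" 0] sum.remove[of "{..p} - {0}" p])
  finally have "(x + y) ^ p - (x ^ p + y ^ p) = (\<Sum>k\<in>{..p} - {0} - {p}. t k)"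
    by (simp add: t_def)
  also have "of_nat p dvd \<dots>"
  proof (intro dvd_sum)
    fix k assume "k \<in> {..p} - {0} - {p}"
    hence "p dvd (p choose k)"
      by (intro dvd_choose_prime p) auto
    thus "of_nat p dvd t k" by (auto simp: t_def mult.assoc elim!: dvdE)
  qed
  finally show ?thesis .
qed

text \<open>Euler's criterion for the non-residue \<open>-7\<close>; by quadratic reciprocity its Legendre symbol at \<open>p\<close> is that
of \<open>p\<close> modulo 7.\<close>
lemma neg7_power_cong:
  assumes p: "prime p" "p = 2 * n + 1" and "p mod 7 \<in> {3, 5, 6}"
  shows "int p dvd (- 7) ^ n + 1"
proof -
  have p7: "p \<noteq> 7" using assms(3) by auto
  have p2: "2 < p" using p prime_ge_2_nat[of p] by (cases "p = 2") auto
  have 7: "prime (7::nat)" by (simp add: prime_nat_numeral_eq)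
  have "[Legendre (int p) 7 = int p ^ 3] (mod 7)"
    using euler_criterion[OF 7, of "int p"] by simp
  moreover have "int p ^ 3 mod 7 = 6"
  proof -
    have "int p mod 7 \<in> {3, 5, 6}" using assms(3) by (auto simp: zmod_int[of p 7, simplified, symmetric])
    hence "(int p mod 7) ^ 3 mod 7 = 6" by auto
    thus ?thesis by (simp add: power_mod)
  qed
  moreover have "Legendre (int p) 7 \<in> {0, 1, - 1}" by (simp add: Legendre_def)
  ultimately have L: "Legendre (int p) 7 = - 1" by (auto simp: cong_def)
  have "Legendre (int p) 7 * Legendre 7 (int p) = (-1) ^ ((p - 1) div 2 * ((7 - 1) div 2))"
    using Quadratic_Reciprocity[OF p(1) p2 7 _ p7] by simp
  hence "Legendre 7 (int p) = - ((- 1) ^ (n * 3))"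
    using L p(2) by simp
  moreover have "[Legendre 7 (int p) = 7 ^ n] (mod int p)"
    using euler_criterion[OF p(1) p2, of 7] p(2) by simp
  ultimately have "[- ((- 1) ^ (n * 3)) = 7 ^ n] (mod int p)" by simp
  hence "[(- 1) ^ n * (- ((- 1) ^ (n * 3))) = (- 1) ^ n * 7 ^ n] (mod int p)"
    by (rule cong_scalar_left)
  moreover have "(- 1 :: int) ^ n * (- ((- 1) ^ (n * 3))) = - 1"
    by (cases "even n") auto
  moreover have "(- 1 :: int) ^ n * 7 ^ n = (- 7) ^ n"
    by (simp flip: power_mult_distrib)
  ultimately have "[- 1 = (- 7) ^ n] (mod int p)" by simp
  hence "int p dvd - 1 - (- 7) ^ n" by (simp add: cong_iff_dvd_diff)
  hence "int p dvd - (- 1 - (- 7) ^ n)" by (rule dvd_minus_iff[THEN iffD2])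
  thus ?thesis by (simp add: algebra_simps)
qed

text \<open>The curve \<open>Y\<^sup>2 = X (X\<^sup>2 + 21 X + 112)\<close> has complex multiplication by \<open>(1 + r)/2\<close>, where \<open>r\<^sup>2 = -7\<close>, and \<open>p\<close> is
inert. To avoid halves the proof uses the twist by 2, \<open>X (X\<^sup>2 + 42 X + 448)\<close>, with Hasse invariant \<open>H\<close>. Moving the
root \<open>-21 + r\<close> or its conjugate to the origin gives \<open>X (X\<^sup>2 + A X + B)\<close> or its conjugate, with the same \<open>H\<close>. The
quotient of the first by \<open>(0, 0)\<close> is a twist of the second, and comparing Hasse invariants yields
\<open>(-2 A)^n H \<equiv> conj(A)^n H\<close>. Since \<open>-8 A = conj(A) (1 + r)\<^sup>2\<close>, this says that \<open>H\<close> is annihilated by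
\<open>(1 + r)^(p-1) - 1\<close> up to units. As \<open>(1 + r)^p \<equiv> 1 - r\<close>, the element \<open>1 + r\<close> is not fixed by Frobenius, and
\<open>H \<equiv> 0\<close> follows.\<close>
lemma central_trinomial_21_112:
  assumes p: "prime p" "p = 2 * n + 1" "p > 3" and nonres: "p mod 7 \<in> {3, 5, 6}"
  shows "int p dvd central_trinomial n 21 112"
proof -
  define h where "h = central_trinomial n 42 (448::int)"
  define H where "H = (of_int h :: zr)"
  define P where "P = (of_nat p :: zr)"
  define r where "r = root7"
  have r2: "r * r = - 7" by (simp add: r_def root7_square)
  define A where "A = (\<lambda>s::zr. 3 * (s - 7))"
  define B where "B = (\<lambda>s::zr. - 14 * (1 + 3 * s))"
  have H: "H = central_trinomial n 42 448"
    unfolding H_def h_def central_trinomial_of_int[symmetric] by simp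
  have shift: "P dvd central_trinomial n (A s) (B s) - H" if s: "s = r \<or> s = - r" for s
  proof -
    have "pcompose [:0, 448, 42, 1:] [:- 21 + s, 1:] = [:0, B s, A s, 1:]"
    proof -
      have "(- 21 + s) * (448 + (- 21 + s) * (42 + (- 21 + s))) = 0"
        "448 + (- 21 + s) * (42 + (- 21 + s)) + (- 21 + s) * (42 + (- 21 + s) + (- 21 + s)) = B s"
        using s unfolding B_def r_def by (auto simp: zr_arith)
      thus ?thesis by (simp add: pcompose_pCons A_def algebra_simps)
    qed
    from coeff_cubic_shift_cong[OF p(1,2), of "[:0, 448, 42, 1:]" "- 21 + s",
           unfolded this coeff_cubic_power]
    show ?thesis by (simp add: H P_def)
  qed
  have c1: "P dvd central_trinomial n (A r) (B r) - H"
    by (rule shift) simp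
  have c2: "P dvd central_trinomial n (A (- r)) (B (- r)) - H"
    by (rule shift) simp
  have c3: "P dvd central_trinomial n (- 2 * A r) (A r ^ 2 - 4 * B r) - central_trinomial n (A r) (B r)"
    unfolding P_def by (rule central_trinomial_isogeny[OF p(1,2)])
  define T where "T = central_trinomial n (- 2 * A r) (A r ^ 2 - 4 * B r)"
  have eq: "A (- r) ^ n * T = (- 2 * A r) ^ n * central_trinomial n (A (- r)) (B (- r))"
  proof -
    have "A (- r) ^ 2 * (A r ^ 2 - 4 * B r) = (- 2 * A r) ^ 2 * B (- r)"
      by (simp add: A_def B_def r_def zr_arith)
    thus ?thesis
      unfolding T_def central_trinomial_scale[symmetric] by (simp add: mult_ac)
  qed
  have "P dvd T - H" using dvd_add[OF c3 c1] by (simp add: T_def)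
  hence d1: "P dvd A (- r) ^ n * (T - H)" by (rule dvd_mult)
  have d2: "P dvd (- 2 * A r) ^ n * (central_trinomial n (A (- r)) (B (- r)) - H)"
    using c2 by (rule dvd_mult)
  have "A (- r) ^ n * (T - H) - (- 2 * A r) ^ n * (central_trinomial n (A (- r)) (B (- r)) - H)
      = H * ((- 2 * A r) ^ n - A (- r) ^ n)"
    unfolding right_diff_distrib eq by (simp add: mult.commute)
  hence "P dvd H * ((- 2 * A r) ^ n - A (- r) ^ n)"
    using dvd_diff[OF d1 d2] by (simp only:)
  hence "P dvd 4 ^ n * (H * ((- 2 * A r) ^ n - A (- r) ^ n))" by (rule dvd_mult)
  also have "4 ^ n * (H * ((- 2 * A r) ^ n - A (- r) ^ n)) = H * A (- r) ^ n * ((1 + r) ^ (2 * n) - 4 ^ n)"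
  proof -
    have "4 * (- 2 * A r) = A (- r) * (1 + r) ^ 2"
      by (simp add: A_def r_def zr_arith)
    hence "4 ^ n * (- 2 * A r) ^ n = A (- r) ^ n * (1 + r) ^ (2 * n)"
      by (metis power_mult power_mult_distrib)
    hence "H * (4 ^ n * (- 2 * A r) ^ n) - H * (4 ^ n * A (- r) ^ n)
      = H * (A (- r) ^ n * (1 + r) ^ (2 * n)) - H * (4 ^ n * A (- r) ^ n)" by simp
    thus ?thesis by (simp only: right_diff_distrib mult_ac)
  qed
  finally have e1: "P dvd H * A (- r) ^ n * ((1 + r) ^ (2 * n) - 4 ^ n)" .
  have four: "P dvd 4 ^ n - 1"
  proof -
    have "\<not> p dvd 2" using p(3) by (auto dest: dvd_imp_le)
    hence "[2 ^ (p - 1) = 1] (mod p)" by (intro fermat_theorem p)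
    hence "int p dvd int (2 ^ (p - 1)) - int 1"
      by (simp only: cong_iff_dvd_diff flip: cong_int_iff)
    also have "int (2 ^ (p - 1)) - int 1 = 4 ^ n - 1"
      using p(2) by (simp add: power_mult)
    finally obtain z where z: "4 ^ n - 1 = int p * z" by (elim dvdE)
    have "(of_int (4 ^ n - 1) :: zr) = of_int (int p * z)" by (simp only: z)
    thus ?thesis by (simp add: P_def)
  qed
  have frob: "P dvd (1 + r) ^ p - (1 - r)"
  proof -
    have "P dvd (1 + r) ^ p - (1 ^ p + r ^ p)"
      unfolding P_def by (rule prime_dvd_add_power_diff[OF p(1)])
    moreover have "P dvd r * ((- 7) ^ n + 1)"
    proof -
      obtain z where z: "(- 7) ^ n + 1 = int p * z"
        using neg7_power_cong[OF p(1,2) nonres] by (elim dvdE)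
      have "(of_int ((- 7) ^ n + 1) :: zr) = of_int (int p * z)" by (simp only: z)
      thus ?thesis by (simp add: P_def)
    qed
    moreover have "r ^ p = r * (- 7) ^ n"
      using r2 by (simp add: p(2) power_mult power2_eq_square)
    ultimately have "P dvd (1 + r) ^ p - (1 ^ p + r * (- 7) ^ n) + r * ((- 7) ^ n + 1)"
      by (intro dvd_add) simp_all
    thus ?thesis by (simp add: algebra_simps)
  qed
  have "P dvd H * A (- r) ^ n * (- 2 * r)"
  proof -
    have "P dvd (1 + r) * (H * A (- r) ^ n * ((1 + r) ^ (2 * n) - 4 ^ n))
         + (1 + r) * (H * A (- r) ^ n) * (4 ^ n - 1) - H * A (- r) ^ n * ((1 + r) ^ p - (1 - r))"
      by (rule dvd_diff[OF dvd_add[OF dvd_mult[OF e1] dvd_mult[OF four]] dvd_mult[OF frob]])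
    also have "\<dots> = H * A (- r) ^ n * (- 2 * r)"
    proof -
      have "(1 + r) ^ p = (1 + r) * (1 + r) ^ (2 * n)" by (simp add: p(2))
      thus ?thesis by (simp add: algebra_simps)
    qed
    finally show ?thesis .
  qed
  \<comment> \<open>multiplying by the conjugates turns the remaining factors into rational integers\<close>
  hence "P dvd (A r ^ n * r) * (H * A (- r) ^ n * (- 2 * r))" by (rule dvd_mult)
  also have "(A r ^ n * r) * (H * A (- r) ^ n * (- 2 * r)) = H * (A r * A (- r)) ^ n * (- 2 * (r * r))"
    by (simp add: power_mult_distrib mult_ac)
  also have "A r * A (- r) = 504"
    by (simp add: A_def r_def zr_arith)
  also have "H * 504 ^ n * (- 2 * (r * r)) = of_int (h * 504 ^ n * 14)"
    by (simp add: r2 H_def)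
  finally have "int p dvd h * 504 ^ n * 14"
    unfolding P_def by (rule of_nat_dvd_of_int_zr)
  moreover have "h = 2 ^ n * central_trinomial n 21 112"
    using central_trinomial_scale[of n 2 "21::int" 112] by (simp add: h_def)
  ultimately have "int p dvd 2 ^ n * central_trinomial n 21 112 * (2 * 2 * 2 * 3 * 3 * 7) ^ n * (2 * 7)"
    by simp
  moreover have "prime (int p)" using p(1) by simp
  moreover have "\<not> int p dvd 2" "\<not> int p dvd 3"
    using p(3) by (auto dest: zdvd_imp_le)
  moreover have "\<not> int p dvd 7"
  proof
    assume "int p dvd 7"
    hence "p dvd 7" by (simp flip: int_dvd_int_iff)
    hence "p = 7" using p(1) by (intro primes_dvd_imp_eq) (simp_all add: prime_nat_numeral_eq)
    thus False using nonres by simp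
  qed
  ultimately have pp: "prime (int p)" and no: "\<not> int p dvd 2" "\<not> int p dvd 3" "\<not> int p dvd 7"
    and dvd: "int p dvd 2 ^ n * central_trinomial n 21 112 * (2 * 2 * 2 * 3 * 3 * 7) ^ n * (2 * 7)"
    by blast+
  have "\<not> int p dvd 2 * 2 * 2 * 3 * 3 * 7" "\<not> int p dvd 2 * 7"
    unfolding prime_dvd_mult_iff[OF pp] using no by blast+
  moreover have "\<not> int p dvd x ^ n" if "\<not> int p dvd x" for x
    using that prime_dvd_power[OF pp] by blast
  ultimately have "\<not> int p dvd 2 ^ n" "\<not> int p dvd (2 * 2 * 2 * 3 * 3 * 7) ^ n" "\<not> int p dvd 2 * 7"
    using no(1) by blast+
  with dvd show ?thesis
    by (metis pp prime_dvd_mult_iff)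
qed

section \<open>From the Hasse invariant to the sums\<close>

text \<open>With \<open>y = B / (16 A\<^sup>2)\<close> modulo \<open>p\<close>, the truncated hypergeometric sum is the trinomial coefficient divided by
\<open>A^n\<close>.\<close>
lemma sum_quart_dvd:
  fixes A B y :: int
  assumes p: "prime p" "p = 2 * n + 1" and A: "\<not> int p dvd A"
    and y: "int p dvd 16 * A ^ 2 * y - B" and T: "int p dvd central_trinomial n A B"
  shows "int p dvd (\<Sum>k<p. int (quart k) * y ^ k)"
proof -
  define c where "c = (\<lambda>k. int ((n choose (2 * k)) * ((2 * k) choose k)))"
  have quart: "[int (quart k) = 16 ^ k * c k] (mod int p)" if "k < p" for k
  proof -
    have "int p dvd int ((2 * k) choose k) * ((- 4) ^ (2 * k) * int (n choose (2 * k)) - int ((2 * (2 * k)) choose (2 * k)))"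
    proof (cases "2 * k < p")
      case True
      thus ?thesis by (intro dvd_mult binomial_half_cong p)
    next
      case False
      thus ?thesis using that by (intro dvd_mult2) (simp add: prime_dvd_choose[OF p(1)])
    qed
    also have "int ((2 * k) choose k) * ((- 4) ^ (2 * k) * int (n choose (2 * k)) - int ((2 * (2 * k)) choose (2 * k)))
       = 16 ^ k * c k - int (quart k)"
    proof -
      have "(- 4 :: int) ^ (2 * k) = 16 ^ k" by (simp add: power_mult)
      thus ?thesis by (simp add: c_def quart_def algebra_simps)
    qed
    finally show ?thesis by (simp add: cong_iff_dvd_diff dvd_diff_commute)
  qed
  have y': "[16 * A ^ 2 * y = B] (mod int p)"
    using y by (simp add: cong_iff_dvd_diff)
  have "[A ^ n * (\<Sum>k<p. int (quart k) * y ^ k) = A ^ n * (\<Sum>k<p. 16 ^ k * c k * y ^ k)] (mod int p)"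
    by (intro cong_scalar_left cong_scalar_right cong_sum quart) auto
  also have "A ^ n * (\<Sum>k<p. 16 ^ k * c k * y ^ k) = A ^ n * (\<Sum>k\<le>n div 2. 16 ^ k * c k * y ^ k)"
    using p(2) by (intro arg_cong[of _ _ "\<lambda>x. A ^ n * x"] sum.mono_neutral_right) (auto simp: c_def binomial_eq_0)
  also have "\<dots> = (\<Sum>k\<le>n div 2. c k * A ^ (n - 2 * k) * (16 * A ^ 2 * y) ^ k)"
    unfolding sum_distrib_left
  proof (intro sum.cong refl)
    fix k assume "k \<in> {..n div 2}"
    hence "n - 2 * k + 2 * k = n" by auto
    hence A: "A ^ n = A ^ (n - 2 * k) * (A ^ 2) ^ k" by (metis power_add power_mult)
    show "A ^ n * (16 ^ k * c k * y ^ k) = c k * A ^ (n - 2 * k) * (16 * A ^ 2 * y) ^ k"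
      unfolding A power_mult_distrib by (simp only: mult_ac)
  qed
  also have "[(\<Sum>k\<le>n div 2. c k * A ^ (n - 2 * k) * (16 * A ^ 2 * y) ^ k)
       = (\<Sum>k\<le>n div 2. c k * A ^ (n - 2 * k) * B ^ k)] (mod int p)"
    by (intro cong_scalar_left cong_sum cong_pow y')
  also have "(\<Sum>k\<le>n div 2. c k * A ^ (n - 2 * k) * B ^ k) = central_trinomial n A B"
    by (simp add: central_trinomial_def c_def)
  finally have "int p dvd A ^ n * (\<Sum>k<p. int (quart k) * y ^ k)"
    using T by (simp add: cong_dvd_iff)
  moreover have pp: "prime (int p)" using p(1) by simp
  ultimately show ?thesis
    using A by (metis prime_dvd_mult_iff prime_dvd_power)
qed

text \<open>Here \<open>1/m = x (1 - 64 x)\<close> at \<open>x = 1/N = B / (16 A\<^sup>2)\<close>. The fraction \<open>1/N\<close> is represented by an integer \<open>y\<close>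
inverse to \<open>N\<close> modulo \<open>p\<^sup>2\<close>, and the sum is multiplied by \<open>m^(p-1)\<close> to stay within the integers.\<close>
lemma sum_quart_central_dvd:
  fixes A B N m :: int
  assumes p: "prime p" "p = 2 * n + 1" and A: "\<not> int p dvd A" and N: "\<not> int p dvd N"
    and NB: "16 * A ^ 2 = N * B" and m: "m * (N - 64) = N ^ 2"
    and T: "int p dvd central_trinomial n A B"
  shows "int p ^ 2 dvd (\<Sum>k<p. int (((2 * k) choose k) * quart k) * m ^ (p - 1 - k))"
proof -
  define L where "L = (\<Sum>k<p. smult (int (((2 * k) choose k) * quart k)) ([:0, 1, - 64:] ^ k))"
  define S where "S = (\<Sum>k<p. monom (int (quart k)) k)"
  have pp: "prime (int p)" using p(1) by simp
  have "coprime (int p) N" using pp N by (rule prime_imp_coprime)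
  hence cN: "coprime N (int p ^ 2)" by (simp add: coprime_commute)
  then obtain y where y: "[N * y = 1] (mod int p ^ 2)"
    using cong_solve_coprime_int by blast
  define w where "w = y - 64 * y ^ 2"
  have yp: "[N * y = 1] (mod int p)"
    using y by (rule cong_dvd_modulus) simp
  have "[N * y * B = 1 * B] (mod int p)"
    using yp by (rule cong_scalar_right)
  hence "int p dvd 16 * A ^ 2 * y - B"
    unfolding NB by (simp add: cong_iff_dvd_diff mult_ac)
  from sum_quart_dvd[OF p A this T] have "int p dvd poly S y"
    by (simp add: S_def poly_sum poly_monom)
  hence "int p ^ 2 dvd poly S y ^ 2" by (simp add: power2_eq_square mult_dvd_mono)
  moreover have "int p ^ 2 dvd poly (L - S ^ 2) y"
  proof -
    have "[:int p ^ 2:] dvd L - S ^ 2"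
      using quart_clausen_truncated[OF p(1)] by (simp add: const_poly_dvd_iff L_def S_def)
    then obtain R where "L - S ^ 2 = [:int p ^ 2:] * R" by (elim dvdE)
    thus ?thesis by (simp only: poly_mult) simp
  qed
  moreover have "poly L y = poly (L - S ^ 2) y + poly S y ^ 2" by simp
  ultimately have "int p ^ 2 dvd poly L y" by (simp only: dvd_add)
  hence Lw: "int p ^ 2 dvd (\<Sum>k<p. int (((2 * k) choose k) * quart k) * w ^ k)"
    by (simp add: L_def w_def poly_sum poly_power power2_eq_square algebra_simps)
  have mw: "[m * w = 1] (mod int p ^ 2)"
  proof -
    have "[m * (N * (N * y) - 64 * (N * y) ^ 2) = m * (N * 1 - 64 * 1 ^ 2)] (mod int p ^ 2)"
      by (intro cong_scalar_left cong_diff cong_pow y)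
    also have "m * (N * (N * y) - 64 * (N * y) ^ 2) = N ^ 2 * (m * w)"
      by (simp add: w_def power2_eq_square algebra_simps)
    also have "m * (N * 1 - 64 * 1 ^ 2) = N ^ 2 * 1" using m by simp
    finally show ?thesis
      using cN by (subst (asm) cong_mult_lcancel) auto
  qed
  have "[(\<Sum>k<p. int (((2 * k) choose k) * quart k) * m ^ (p - 1 - k) * 1 ^ k)
     = (\<Sum>k<p. int (((2 * k) choose k) * quart k) * m ^ (p - 1 - k) * (m * w) ^ k)] (mod int p ^ 2)"
    by (intro cong_sum cong_scalar_left cong_pow cong_sym[OF mw])
  also have "(\<Sum>k<p. int (((2 * k) choose k) * quart k) * m ^ (p - 1 - k) * (m * w) ^ k)
     = m ^ (p - 1) * (\<Sum>k<p. int (((2 * k) choose k) * quart k) * w ^ k)"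
    unfolding sum_distrib_left
  proof (intro sum.cong refl)
    fix k assume "k \<in> {..<p}"
    hence "p - 1 - k + k = p - 1" by auto
    hence m: "m ^ (p - 1) = m ^ (p - 1 - k) * m ^ k" by (metis power_add)
    show "int (((2 * k) choose k) * quart k) * m ^ (p - 1 - k) * (m * w) ^ k
      = m ^ (p - 1) * (int (((2 * k) choose k) * quart k) * w ^ k)"
      unfolding m power_mult_distrib by (simp only: mult_ac)
  qed
  finally show ?thesis
    using Lw by (simp add: cong_dvd_iff)
qed

lemma of_int_div_in_p_integers:
  assumes "coprime b (int p)" "b \<noteq> 0"
  shows "of_int a / of_int b \<in> p_integers p"
proof -
  obtain u v where uv: "quotient_of (of_int a / of_int b) = (u, v)"
    by (rule prod.exhaust)
  have v: "v > 0" "coprime u v"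
    using quotient_of_denom_pos[OF uv] quotient_of_coprime[OF uv] by simp_all
  have "(of_int a / of_int b :: rat) = of_int u / of_int v"
    using uv by (rule quotient_of_div)
  hence "(of_int (a * v) :: rat) = of_int (u * b)"
    using v assms(2) by (simp add: field_simps)
  hence "a * v = u * b" by (simp only: of_int_eq_iff)
  hence "v dvd u * b" by (metis dvd_triv_right)
  hence "v dvd b" using v(2) by (simp add: coprime_commute coprime_dvd_mult_right_iff)
  hence "coprime v (int p)" using assms(1) by (metis coprime_divisors dvd_refl)
  thus ?thesis by (simp add: p_integers_def uv)
qed

lemma rat_cong_sum_zero:
  fixes g :: "nat \<Rightarrow> nat" and m :: int
  assumes p: "prime p" and m: "\<not> int p dvd m"
    and dvd: "int p ^ 2 dvd (\<Sum>k<p. int (g k) * m ^ (p - 1 - k))"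
  shows "rat_cong p (of_nat p ^ 2) (\<Sum>k = 0..p - 1. of_nat (g k) / of_int m ^ k) 0"
proof -
  have m0: "m \<noteq> 0" using m by auto
  have p0: "p > 0" using p by (rule prime_gt_0_nat)
  have "coprime (int p) m" using p m by (intro prime_imp_coprime) auto
  hence cop: "coprime (m ^ (p - 1)) (int p)" by (simp add: coprime_commute)
  define s where "s = (\<Sum>k<p. int (g k) * m ^ (p - 1 - k))"
  obtain t where t: "s = int p ^ 2 * t" using dvd unfolding s_def by (elim dvdE)
  have ran: "{0..p - 1} = {..<p}" using p0 by auto
  have "(\<Sum>k = 0..p - 1. of_nat (g k) / of_int m ^ k :: rat) = of_int s / of_int (m ^ (p - 1))"
    unfolding ran s_def of_int_sum sum_divide_distrib
  proof (intro sum.cong refl)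
    fix k assume "k \<in> {..<p}"
    hence "p - 1 - k + k = p - 1" by auto
    hence m: "(of_int (m ^ (p - 1)) :: rat) = of_int m ^ (p - 1 - k) * of_int m ^ k"
      by (metis power_add of_int_power)
    show "(of_nat (g k) / of_int m ^ k :: rat) = of_int (int (g k) * m ^ (p - 1 - k)) / of_int (m ^ (p - 1))"
      unfolding m using m0 by simp
  qed
  moreover have "(of_int s / of_int (m ^ (p - 1)) :: rat) = of_nat p ^ 2 * (of_int t / of_int (m ^ (p - 1)))"
    by (simp add: t)
  moreover have "(of_int x / of_int (m ^ (p - 1)) :: rat) \<in> p_integers p" for x
    using cop m0 by (intro of_int_div_in_p_integers) auto
  moreover have "(0::rat) \<in> p_integers p"
    using of_int_div_in_p_integers[of 1 p 0] by simp
  ultimately show ?thesis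
    unfolding rat_cong_def by (metis diff_0_right)
qed

theorem theorem3p11:
  fixes p :: nat
  assumes "prime p" and "p > 3"
  shows "(p mod 4 = 3 \<longrightarrow>
            rat_cong p (of_nat p ^ 2)
              (\<Sum>k = 0..p - 1. of_nat (((2 * k) choose k) ^ 2 * ((4 * k) choose (2 * k))) / 648 ^ k) 0)
       \<and> (p mod 3 = 2 \<longrightarrow>
            rat_cong p (of_nat p ^ 2)
              (\<Sum>k = 0..p - 1. of_nat (((2 * k) choose k) ^ 2 * ((4 * k) choose (2 * k))) / (- 144) ^ k) 0)
       \<and> (p mod 7 \<in> {3, 5, 6} \<longrightarrow>
            rat_cong p (of_nat p ^ 2)
              (\<Sum>k = 0..p - 1. of_nat (((2 * k) choose k) ^ 2 * ((4 * k) choose (2 * k))) / (- 3969) ^ k) 0)"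
proof -
  have "odd p" using assms prime_odd_nat[of p] by simp
  then obtain n where n: "p = 2 * n + 1" by (elim oddE)
  have pp: "prime (int p)" using assms(1) by simp
  have p23: "\<not> int p dvd 2" "\<not> int p dvd 3"
    using assms(2) by (auto dest: zdvd_imp_le)
  have p7: "\<not> int p dvd 7" if "p mod 7 \<in> {3, 5, 6}"
  proof
    assume "int p dvd 7"
    hence "int p dvd int 7" by simp
    hence "p dvd 7" by (simp only: int_dvd_int_iff)
    hence "p = 7" using assms(1) by (intro primes_dvd_imp_eq) (simp_all add: prime_nat_numeral_eq)
    thus False using that by simp
  qed
  have split: "\<not> int p dvd a * b" if "\<not> int p dvd a" "\<not> int p dvd b" for a b
    using that pp by (simp add: prime_dvd_mult_iff)
  have gen: "rat_cong p (of_nat p ^ 2)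
       (\<Sum>k = 0..p - 1. of_nat (((2 * k) choose k) ^ 2 * ((4 * k) choose (2 * k))) / of_int m ^ k) 0"
    if "\<not> int p dvd A" "\<not> int p dvd N" "16 * A ^ 2 = N * B" "m * (N - 64) = N ^ 2"
      "int p dvd central_trinomial n A B" for A B N m :: int
  proof -
    have "\<not> int p dvd m"
      using that(2,4) pp by (metis dvd_mult2 prime_dvd_power)
    from rat_cong_sum_zero[OF assms(1) this sum_quart_central_dvd[OF assms(1) n that]]
    show ?thesis by (simp only: quart_def power2_eq_square mult.assoc)
  qed
  show ?thesis
  proof (intro conjI impI)
    assume "p mod 4 = 3"
    hence "odd n" using n by presburger
    have "\<not> int p dvd 2 * 2 * 2 * 3 * 3" by (intro split p23)
    hence "\<not> int p dvd 72" by simp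
    with gen[of 3 72 2 648] p23 central_trinomial_3_2[OF assms(1) n \<open>odd n\<close>]
    show "rat_cong p (of_nat p ^ 2)
      (\<Sum>k = 0..p - 1. of_nat (((2 * k) choose k) ^ 2 * ((4 * k) choose (2 * k))) / 648 ^ k) 0"
      by simp
  next
    assume "p mod 3 = 2"
    hence "\<not> 3 dvd n" using n by presburger
    have "\<not> int p dvd 2 * 2 * 2 * 2 * 3" by (intro split p23)
    hence "\<not> int p dvd 48" by simp
    with gen[of 3 48 3 "- 144"] p23 central_trinomial_3_3[OF assms(1) n \<open>\<not> 3 dvd n\<close>]
    show "rat_cong p (of_nat p ^ 2)
      (\<Sum>k = 0..p - 1. of_nat (((2 * k) choose k) ^ 2 * ((4 * k) choose (2 * k))) / (- 144) ^ k) 0"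
      by simp
  next
    assume 7: "p mod 7 \<in> {3, 5, 6}"
    have "\<not> int p dvd 3 * 7" "\<not> int p dvd 3 * 3 * 7" by (intro split p23 p7[OF 7])+
    hence "\<not> int p dvd 21" "\<not> int p dvd 63" by simp_all
    with gen[of 21 63 112 "- 3969"] central_trinomial_21_112[OF assms(1) n assms(2) 7]
    show "rat_cong p (of_nat p ^ 2)
      (\<Sum>k = 0..p - 1. of_nat (((2 * k) choose k) ^ 2 * ((4 * k) choose (2 * k))) / (- 3969) ^ k) 0"
      by simp
  qed
qed

end
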